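(* Let $X$ be a compact metric space with metric $d$ and let $f\colon X\to X$ be a continuous map. If $X$ is locally connected, $f$ has the shadowing property, and $CR(f)$ is totally disconnected, then $f$ is almost chain continuous.
   Context: Let $(X,d)$ be a compact metric space and $f\colon X\to X$ a continuous map. $X$ is locally connected if for every $x\in X$ and every open $U\subset X$ with $x\in U$ there is an open connected subset $V$ of $X$ with $x\in V\subset U$. Chain recurrent set: for $\delta>0$, a $\delta$-chain of $f$ is a finite sequence $(x_i)_{i=0}^k$ of points of $X$ with $k>0$ and $d(f(x_i),x_{i+1})\le\delta$ for all $0\le i\le k-1$. $CR(f)$ is the set of $x\in X$ such that for every $\delta>0$ there is a $\delta$-chain $(x_i)_{i=0}^k$ of $f$ with $x_0=x_k=x$. Shadowing: for $\delta>0$, a sequence $(x_i)_{i\ge0}$ in $X$ is a $\delta$-pseudo orbit of $f$ if $d(f(x_i),x_{i+1})\le\delta$ for all $i\ge0$; for $\epsilon>0$, it is $\epsilon$-shadowed by $x\in X$ if $d(f^i(x),x_i)\le\epsilon$ for all $i\ge0$. The map $f$ has the shadowing property if for every $\epsilon>0$ there is $\delta>0$ such that every $\delta$-pseudo orbit of $f$ is $\epsilon$-shadowed by some point of $X$. Chain continuity: $f$ is chain continuous at $x\in X$ if for every $\epsilon>0$ there is $\delta>0$ such that every $\delta$-pseudo orbit $(x_i)_{i\ge0}$ of $f$ with $x_0=x$ is $\epsilon$-shadowed by $x$. $CC(f)$ denotes the set of points of $X$ at which $f$ is chain continuous. The map $f$ is almost chain continuous if $CC(f)$ is a dense $G_\delta$-subset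 of $X$. *)

theory Defs
  imports "HOL-Analysis.Analysis"
begin

text \<open>
  The space is a subset \<open>X\<close> of a metric type carrying the induced metric; the map is
  given by a function \<open>f\<close> on the ambient type of which only the values on \<open>X\<close> matter
  (\<open>f\<close> maps \<open>X\<close> into itself). Topological notions are those of \<open>top_of_set X\<close>.
\<close>

text \<open>
  A finite sequence \<open>x\<^sub>0, \<dots>, x\<^sub>k\<close> is represented by \<open>x :: nat \<Rightarrow> 'a\<close> together with \<open>k\<close>;
  the values beyond \<open>k\<close> are unconstrained.
\<close>

definition delta_chain ::
  "'a::metric_space set \<Rightarrow> ('a \<Rightarrow> 'a) \<Rightarrow> real \<Rightarrow> nat \<Rightarrow> (nat \<Rightarrow> 'a) \<Rightarrow> bool" where
  "delta_chain X f \<delta> k x \<longleftrightarrow>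
     k > 0 \<and> (\<forall>i\<le>k. x i \<in> X) \<and> (\<forall>i<k. dist (f (x i)) (x (Suc i)) \<le> \<delta>)"

definition chain_recurrent_set :: "'a::metric_space set \<Rightarrow> ('a \<Rightarrow> 'a) \<Rightarrow> 'a set" where
  "chain_recurrent_set X f =
     {p \<in> X. \<forall>\<delta>>0. \<exists>k x. delta_chain X f \<delta> k x \<and> x 0 = p \<and> x k = p}"

definition pseudo_orbit ::
  "'a::metric_space set \<Rightarrow> ('a \<Rightarrow> 'a) \<Rightarrow> real \<Rightarrow> (nat \<Rightarrow> 'a) \<Rightarrow> bool" where
  "pseudo_orbit X f \<delta> x \<longleftrightarrow>
     (\<forall>i. x i \<in> X) \<and> (\<forall>i. dist (f (x i)) (x (Suc i)) \<le> \<delta>)"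

definition shadowed_by ::
  "('a::metric_space \<Rightarrow> 'a) \<Rightarrow> real \<Rightarrow> (nat \<Rightarrow> 'a) \<Rightarrow> 'a \<Rightarrow> bool" where
  "shadowed_by f \<epsilon> x p \<longleftrightarrow> (\<forall>i. dist ((f ^^ i) p) (x i) \<le> \<epsilon>)"

definition shadowing_property :: "'a::metric_space set \<Rightarrow> ('a \<Rightarrow> 'a) \<Rightarrow> bool" where
  "shadowing_property X f \<longleftrightarrow>
     (\<forall>\<epsilon>>0. \<exists>\<delta>>0. \<forall>x. pseudo_orbit X f \<delta> x \<longrightarrow> (\<exists>p\<in>X. shadowed_by f \<epsilon> x p))"

definition chain_continuous_at :: "'a::metric_space set \<Rightarrow> ('a \<Rightarrow> 'a) \<Rightarrow> 'a \<Rightarrow> bool" where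
  "chain_continuous_at X f p \<longleftrightarrow>
     (\<forall>\<epsilon>>0. \<exists>\<delta>>0. \<forall>x. pseudo_orbit X f \<delta> x \<and> x 0 = p \<longrightarrow> shadowed_by f \<epsilon> x p)"

definition chain_continuity_set :: "'a::metric_space set \<Rightarrow> ('a \<Rightarrow> 'a) \<Rightarrow> 'a set" where
  "chain_continuity_set X f = {p \<in> X. chain_continuous_at X f p}"

text \<open>
  Density and being a \<open>G\<^sub>\<delta>\<close> are relative to \<open>X\<close>; the predicate \<open>gdelta\<close> of
  \<open>Lebesgue_Measure\<close> would refer to the ambient type instead.
\<close>

definition almost_chain_continuous :: "'a::metric_space set \<Rightarrow> ('a \<Rightarrow> 'a) \<Rightarrow> bool" where
  "almost_chain_continuous X f \<longleftrightarrow>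
     gdelta_in (top_of_set X) (chain_continuity_set X f) \<and>
     top_of_set X closure_of chain_continuity_set X f = X"

definition totally_disconnected :: "'a::topological_space set \<Rightarrow> bool" where
  "totally_disconnected S \<longleftrightarrow> (\<forall>C. C \<subseteq> S \<and> connected C \<longrightarrow> (\<exists>a. C \<subseteq> {a}))"

text \<open>
  The library's \<open>locally connected X\<close> asks for connected neighbourhoods that need not be
  open; required at all points this is the same as a base of open connected sets.
\<close>

lemma locally_connected_iff_open_base:
  "locally connected X \<longleftrightarrow>
     (\<forall>U x. openin (top_of_set X) U \<and> x \<in> U \<longrightarrow>
       (\<exists>V. openin (top_of_set X) V \<and> connected V \<and> x \<in> V \<and> V \<subseteq> U))"
  by (rule locally_connected)

end

theory Submission
  imports Defs
begin

text \<open>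
  Under shadowing, chain continuity is nothing but stability of true orbits, so the point is to
  find, in every open set, a small neighbourhood all of whose iterates stay small. Such a
  neighbourhood is found by steering into an attracting part of the chain recurrent set.

  Order the points of \<open>X\<close> by chain reachability at all scales. From a given point \<open>p\<close>, Zorn's
  lemma provides a point \<open>w\<close> that is minimal among those reachable from \<open>p\<close>
  (\<open>minimal_compact_invariant_subset\<close>). The set \<open>T\<close> of points reachable from \<open>w\<close> is compact, it
  consists of chain recurrent points because each of its points reaches all of it
  (\<open>terminal_chain_class\<close>), and it is stable: \<open>\<delta>\<close>-chains that leave \<open>w\<close> stay near \<open>T\<close> when \<open>\<delta>\<close>
  is small (\<open>fine_chains_stay_near_reachable_set\<close>). In particular every true orbit that starts
  \<open>\<delta>\<close>-close to \<open>f w\<close> stays near \<open>T\<close>.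

  A chain from \<open>p\<close> to \<open>w\<close>, continued by the orbit of \<open>w\<close>, is a pseudo orbit; a point \<open>y\<close>
  shadowing it is close to \<open>p\<close>, and some iterate of \<open>y\<close> is \<open>\<delta>\<close>-close to \<open>f w\<close>. By local
  connectedness \<open>y\<close> has a connected neighbourhood \<open>V\<close> whose first few iterates are small and
  whose later iterates stay near \<open>T\<close>. Since \<open>T\<close> is compact and totally disconnected, a connected
  set near \<open>T\<close> has small diameter (\<open>connected_sets_near_totally_disconnected_are_small\<close>); hence
  all iterates of \<open>V\<close> are small.

  This makes the open sets of points that are stable up to a given error \<open>\<epsilon>\<close> dense. The chain
  continuity set is their intersection over \<open>\<epsilon> = 1, 1/2, 1/3, \<dots>\<close>, and Baire's theorem applies.
\<close>

section \<open>Chain reachability\<close>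

definition chain_step :: "'a::metric_space set \<Rightarrow> ('a \<Rightarrow> 'a) \<Rightarrow> real \<Rightarrow> 'a \<Rightarrow> 'a \<Rightarrow> bool" where
  "chain_step X f \<delta> p q \<longleftrightarrow> p \<in> X \<and> q \<in> X \<and> dist (f p) q \<le> \<delta>"

definition reachable_set :: "'a::metric_space set \<Rightarrow> ('a \<Rightarrow> 'a) \<Rightarrow> 'a \<Rightarrow> 'a set" where
  "reachable_set X f p = {q. \<forall>\<delta>>0. (chain_step X f \<delta>)\<^sup>+\<^sup>+ p q}"

lemma delta_chain_iff_tranclp:
  "(\<exists>k x. delta_chain X f \<delta> k x \<and> x 0 = p \<and> x k = q) \<longleftrightarrow> (chain_step X f \<delta>)\<^sup>+\<^sup>+ p q"
proof -
  have "delta_chain X f \<delta> k x \<longleftrightarrow> k > 0 \<and> (\<forall>i<k. chain_step X f \<delta> (x i) (x (Suc i)))" for k x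
  proof
    assume R: "k > 0 \<and> (\<forall>i<k. chain_step X f \<delta> (x i) (x (Suc i)))"
    have "x i \<in> X" if "i \<le> k" for i
    proof (cases i)
      case 0
      then show ?thesis using R by (auto simp: chain_step_def)
    next
      case (Suc j)
      then show ?thesis using R that by (auto simp: chain_step_def)
    qed
    then show "delta_chain X f \<delta> k x"
      using R by (auto simp: delta_chain_def chain_step_def)
  qed (auto simp: delta_chain_def chain_step_def)
  then show ?thesis
    unfolding tranclp_power relpowp_fun_conv by metis
qed

lemma chain_recurrent_iff_reachable:
  "p \<in> chain_recurrent_set X f \<longleftrightarrow> p \<in> X \<and> p \<in> reachable_set X f p"
  by (simp add: chain_recurrent_set_def reachable_set_def delta_chain_iff_tranclp)

lemma chain_step_tranclp_mono:
  assumes "(chain_step X f \<delta>)\<^sup>+\<^sup>+ p q" and "\<delta> \<le> \<eta>"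
  shows "(chain_step X f \<eta>)\<^sup>+\<^sup>+ p q"
  using assms(1)
proof induction
  case (base q)
  then show ?case using assms(2) by (intro tranclp.r_into_trancl) (auto simp: chain_step_def)
next
  case (step q r)
  then have "chain_step X f \<eta> q r"
    using assms(2) by (auto simp: chain_step_def)
  with step.IH show ?case by (rule tranclp.trancl_into_trancl)
qed

lemma chain_step_tranclp_perturb_end:
  assumes "(chain_step X f \<delta>)\<^sup>+\<^sup>+ p q" and "r \<in> X" and "dist q r \<le> \<eta>"
  shows "(chain_step X f (\<delta> + \<eta>))\<^sup>+\<^sup>+ p r"
proof -
  have "0 \<le> \<eta>"
    using assms(3) zero_le_dist[of q r] by linarith
  have last: "chain_step X f (\<delta> + \<eta>) a r" if "chain_step X f \<delta> a q" for a
    using that assms(2,3) dist_triangle[of "f a" r q] by (auto simp: chain_step_def)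
  from assms(1) show ?thesis
  proof (cases rule: tranclp.cases)
    case r_into_trancl
    then show ?thesis using last by blast
  next
    case (trancl_into_trancl a)
    then have "(chain_step X f (\<delta> + \<eta>))\<^sup>+\<^sup>+ p a"
      using chain_step_tranclp_mono \<open>0 \<le> \<eta>\<close> by (metis le_add_same_cancel1)
    then show ?thesis using last[OF trancl_into_trancl(2)] by (rule tranclp.trancl_into_trancl)
  qed
qed

lemma chain_step_tranclp_in_space:
  "(chain_step X f \<delta>)\<^sup>+\<^sup>+ p q \<Longrightarrow> q \<in> X"
  by (induction rule: tranclp_induct) (auto simp: chain_step_def)

lemma reachable_set_subset: "reachable_set X f p \<subseteq> X"
  using chain_step_tranclp_in_space zero_less_one unfolding reachable_set_def by blast

lemma reachable_set_trans:
  assumes "q \<in> reachable_set X f p"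
  shows "reachable_set X f q \<subseteq> reachable_set X f p"
  using assms by (auto simp: reachable_set_def intro: tranclp_trans)

lemma image_in_reachable_set:
  assumes "p \<in> X" and "f p \<in> X"
  shows "f p \<in> reachable_set X f p"
  using assms by (auto simp: reachable_set_def chain_step_def)

text \<open>The last point of a chain may be moved at the price of a slightly larger error, so a limit
  of endpoints of arbitrarily fine chains is reachable at all scales. Closedness and stability of
  reachable sets both come from this.\<close>

lemma reachable_set_limit:
  assumes "l \<in> X" and q: "\<And>\<eta>. \<eta> > 0 \<Longrightarrow> \<exists>q. (chain_step X f \<eta>)\<^sup>+\<^sup>+ p q \<and> dist q l \<le> \<eta>"
  shows "l \<in> reachable_set X f p"
  unfolding reachable_set_def
proof (intro CollectI allI impI)
  fix \<delta> :: real assume "\<delta> > 0"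
  then obtain q where "(chain_step X f (\<delta>/2))\<^sup>+\<^sup>+ p q" "dist q l \<le> \<delta>/2"
    using q[of "\<delta>/2"] by auto
  then have "(chain_step X f (\<delta>/2 + \<delta>/2))\<^sup>+\<^sup>+ p l"
    using \<open>l \<in> X\<close> by (intro chain_step_tranclp_perturb_end)
  then show "(chain_step X f \<delta>)\<^sup>+\<^sup>+ p l" by simp
qed

lemma compact_reachable_set:
  assumes "compact X"
  shows "compact (reachable_set X f p)"
proof -
  have "closed (reachable_set X f p)"
    unfolding closed_sequential_limits
  proof (intro allI impI)
    fix z l assume zl: "(\<forall>n. z n \<in> reachable_set X f p) \<and> z \<longlonglongrightarrow> l"
    show "l \<in> reachable_set X f p"
    proof (rule reachable_set_limit)
      show "l \<in> X"
        using zl assms reachable_set_subset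
        by (metis closed_sequentially compact_imp_closed subsetD)
      show "\<exists>q. (chain_step X f \<eta>)\<^sup>+\<^sup>+ p q \<and> dist q l \<le> \<eta>" if \<eta>: "\<eta> > 0" for \<eta>
      proof -
        obtain n where "dist (z n) l < \<eta>"
          using zl \<eta> unfolding lim_sequentially by (meson order.refl)
        then show ?thesis
          using zl \<eta> by (auto simp: reachable_set_def intro!: exI[of _ "z n"])
      qed
    qed
  qed
  then show ?thesis
    using assms reachable_set_subset[of X f p] compact_Int_closed[of X] by (metis inf.absorb2)
qed

text \<open>If the statement failed, endpoints of finer and finer chains would accumulate at a reachable
  point, to which they were supposed not to be close.\<close>

lemma fine_chains_stay_near_reachable_set:
  assumes "compact X" and "\<beta> > 0"
  obtains \<delta> where "\<delta> > 0"
    and "\<And>q. (chain_step X f \<delta>)\<^sup>+\<^sup>+ p q \<Longrightarrow> \<exists>r\<in>reachable_set X f p. dist q r < \<beta>"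
proof (rule ccontr)
  assume "\<not> thesis"
  then have "\<forall>n. \<exists>q. (chain_step X f (1 / real (Suc n)))\<^sup>+\<^sup>+ p q
      \<and> \<not> (\<exists>r\<in>reachable_set X f p. dist q r < \<beta>)"
    using that by (metis of_nat_0_less_iff zero_less_Suc zero_less_divide_1_iff)
  then obtain z where z: "\<And>n. (chain_step X f (1 / real (Suc n)))\<^sup>+\<^sup>+ p (z n)"
    and far: "\<And>n r. r \<in> reachable_set X f p \<Longrightarrow> \<not> dist (z n) r < \<beta>"
    by metis
  have "\<forall>n. z n \<in> X"
    using z chain_step_tranclp_in_space by blast
  then obtain l s where "l \<in> X" "strict_mono (s :: nat \<Rightarrow> nat)" and lim: "(z \<circ> s) \<longlonglongrightarrow> l"
    using \<open>compact X\<close> unfolding compact_def by metis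
  have close: "\<exists>n. 1 / real (Suc (s n)) \<le> \<eta> \<and> dist (z (s n)) l < \<eta>" if \<eta>: "\<eta> > 0" for \<eta>
  proof -
    obtain N where N: "\<And>n. n \<ge> N \<Longrightarrow> dist (z (s n)) l < \<eta>"
      using lim \<eta> unfolding lim_sequentially by (auto simp: comp_def)
    obtain M where M: "1 / real (Suc M) < \<eta>"
      using reals_Archimedean[OF \<eta>] by (auto simp: inverse_eq_divide)
    have "M \<le> s (max M N)"
      using seq_suble[OF \<open>strict_mono s\<close>, of "max M N"] by simp
    then have "1 / real (Suc (s (max M N))) \<le> 1 / real (Suc M)"
      by (intro divide_left_mono) auto
    then show ?thesis
      using N[of "max M N"] M by (intro exI[of _ "max M N"]) auto
  qed
  have "l \<in> reachable_set X f p"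
  proof (rule reachable_set_limit[OF \<open>l \<in> X\<close>])
    show "\<exists>q. (chain_step X f \<eta>)\<^sup>+\<^sup>+ p q \<and> dist q l \<le> \<eta>" if "\<eta> > 0" for \<eta>
      using close[OF that] z chain_step_tranclp_mono by (metis less_imp_le)
  qed
  then show False
    using close[OF \<open>\<beta> > 0\<close>] far by blast
qed

section \<open>Terminal chain classes\<close>

text \<open>A chain of nonempty compact sets has nonempty intersection, so Zorn's lemma gives a minimal
  set; it is applied to the complements, which turns minimal into maximal.\<close>

lemma minimal_compact_invariant_subset:
  fixes R :: "'a::t2_space \<Rightarrow> 'a set"
  assumes S: "compact S" "S \<noteq> {}" "\<And>z. z \<in> S \<Longrightarrow> R z \<subseteq> S"
  obtains T where "T \<subseteq> S" "compact T" "T \<noteq> {}" "\<And>z. z \<in> T \<Longrightarrow> R z \<subseteq> T"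
    and "\<forall>U. U \<subseteq> T \<and> compact U \<and> U \<noteq> {} \<and> (\<forall>z\<in>U. R z \<subseteq> U) \<longrightarrow> U = T"
proof -
  define inv where "inv T \<longleftrightarrow> T \<subseteq> S \<and> compact T \<and> T \<noteq> {} \<and> (\<forall>z\<in>T. R z \<subseteq> T)" for T
  have "inv S"
    using S by (auto simp: inv_def)
  have "\<exists>M\<in>uminus ` Collect inv. \<forall>Y\<in>uminus ` Collect inv. M \<subseteq> Y \<longrightarrow> Y = M"
  proof (rule subset_Zorn_nonempty)
    show "uminus ` Collect inv \<noteq> {}"
      using \<open>inv S\<close> by blast
    fix \<C> assume "\<C> \<noteq> {}" and ch: "subset.chain (uminus ` Collect inv) \<C>"
    define \<D> where "\<D> = uminus ` \<C>"
    have \<D>: "\<D> \<noteq> {}" "\<And>D. D \<in> \<D> \<Longrightarrow> inv D" "\<And>D E. D \<in> \<D> \<Longrightarrow> E \<in> \<D> \<Longrightarrow> D \<subseteq> E \<or> E \<subseteq> D"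
      using \<open>\<C> \<noteq> {}\<close> ch by (auto simp: \<D>_def subset_chain_def)
    have fin: "\<Inter>\<F> \<in> \<D>" if "finite \<F>" "\<F> \<noteq> {}" "\<F> \<subseteq> \<D>" for \<F>
      using that
    proof (induction rule: finite_ne_induct)
      case (insert F \<F>)
      then have "F \<subseteq> \<Inter>\<F> \<or> \<Inter>\<F> \<subseteq> F"
        using \<D>(3) by auto
      then show ?case
        using insert by (auto simp: inf.absorb1 inf.absorb2)
    qed simp
    obtain D0 where "D0 \<in> \<D>"
      using \<D>(1) by blast
    have "S \<inter> \<Inter>\<D> \<noteq> {}"
    proof (rule compact_imp_fip[OF \<open>compact S\<close>])
      show "closed D" if "D \<in> \<D>" for D
        using \<D>(2)[OF that] compact_imp_closed by (auto simp: inv_def)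
      show "S \<inter> \<Inter>\<F> \<noteq> {}" if "finite \<F>" "\<F> \<subseteq> \<D>" for \<F>
      proof (cases "\<F> = {}")
        case True
        then show ?thesis using S by simp
      next
        case False
        then have "inv (\<Inter>\<F>)"
          using fin[OF that(1) _ that(2)] \<D>(2) by blast
        then show ?thesis by (auto simp: inv_def)
      qed
    qed
    moreover have "compact (\<Inter>\<D>)"
      using \<D>(1,2) compact_imp_closed \<open>D0 \<in> \<D>\<close>
      by (metis Inter_lower closed_Inter compact_Int_closed inf.absorb2 inv_def)
    moreover have "\<Inter>\<D> \<subseteq> S"
      using \<D>(2)[OF \<open>D0 \<in> \<D>\<close>] \<open>D0 \<in> \<D>\<close> by (auto simp: inv_def)
    moreover have "R z \<subseteq> \<Inter>\<D>" if "z \<in> \<Inter>\<D>" for z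
      using that \<D>(2) unfolding inv_def by blast
    ultimately have "inv (\<Inter>\<D>)"
      unfolding inv_def by blast
    moreover have "\<Union>\<C> = - \<Inter>\<D>"
      by (auto simp: \<D>_def)
    ultimately show "\<Union>\<C> \<in> uminus ` Collect inv"
      by blast
  qed
  then obtain T where "inv T" and min: "\<And>U. inv U \<Longrightarrow> U \<subseteq> T \<Longrightarrow> U = T"
    by auto
  show ?thesis
  proof (rule that[of T])
    show "\<forall>U. U \<subseteq> T \<and> compact U \<and> U \<noteq> {} \<and> (\<forall>z\<in>U. R z \<subseteq> U) \<longrightarrow> U = T"
    proof (intro allI impI)
      fix U assume U: "U \<subseteq> T \<and> compact U \<and> U \<noteq> {} \<and> (\<forall>z\<in>U. R z \<subseteq> U)"
      then have "inv U"
        using \<open>inv T\<close> by (auto simp: inv_def)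
      then show "U = T"
        using min U by simp
    qed
  qed (use \<open>inv T\<close> in \<open>auto simp: inv_def\<close>)
qed

text \<open>In a minimal reachability-invariant set every point reaches every point, itself included.\<close>

lemma terminal_chain_class:
  assumes "compact X" and "f \<in> X \<rightarrow> X" and "p \<in> X"
  obtains w where "w \<in> reachable_set X f p"
    and "reachable_set X f w \<subseteq> chain_recurrent_set X f"
proof -
  have ne: "reachable_set X f z \<noteq> {}" if "z \<in> X" for z
    using image_in_reachable_set[of z X f] that assms(2) by blast
  obtain T where T: "T \<subseteq> reachable_set X f p" "compact T" "T \<noteq> {}" "\<And>z. z \<in> T \<Longrightarrow> reachable_set X f z \<subseteq> T"
    and min: "\<forall>U. U \<subseteq> T \<and> compact U \<and> U \<noteq> {} \<and> (\<forall>z\<in>U. reachable_set X f z \<subseteq> U) \<longrightarrow> U = T"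
  proof (rule minimal_compact_invariant_subset)
    show "compact (reachable_set X f p)" by (rule compact_reachable_set[OF \<open>compact X\<close>])
    show "reachable_set X f p \<noteq> {}" by (rule ne[OF \<open>p \<in> X\<close>])
    show "reachable_set X f z \<subseteq> reachable_set X f p" if "z \<in> reachable_set X f p" for z
      using that by (rule reachable_set_trans)
  qed (rule that)
  have TX: "T \<subseteq> X"
    using T(1) reachable_set_subset[of X f p] by blast
  have eq: "reachable_set X f z = T" if "z \<in> T" for z
  proof (rule min[rule_format], intro conjI ballI)
    show "reachable_set X f z \<subseteq> T" by (rule T(4)[OF that])
    show "compact (reachable_set X f z)" by (rule compact_reachable_set[OF \<open>compact X\<close>])
    show "reachable_set X f z \<noteq> {}" using that TX ne by blast
    show "reachable_set X f u \<subseteq> reachable_set X f z" if "u \<in> reachable_set X f z" for u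
      using that by (rule reachable_set_trans)
  qed
  obtain w where "w \<in> T"
    using T(3) by blast
  moreover have "T \<subseteq> chain_recurrent_set X f"
    using eq TX by (auto simp: chain_recurrent_iff_reachable)
  ultimately show ?thesis
    using that T(1) eq by blast
qed

section \<open>Connected sets near a totally disconnected compact set\<close>

text \<open>In a compact Hausdorff space components are quasi-components, hence a totally disconnected
  one has a base of clopen sets.\<close>

lemma totally_disconnected_clopen_base:
  fixes T :: "'a::metric_space set"
  assumes "compact T" and "totally_disconnected T" and "a \<in> T" and "r > 0"
  obtains K where "openin (top_of_set T) K" "closedin (top_of_set T) K" "a \<in> K" "K \<subseteq> ball a r"
proof -
  have "separated_between (top_of_set T) {a} (T - ball a r)"
  proof (rule cut_wire_fence_theorem_gen)
    show "compact_space (top_of_set T)"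
      using \<open>compact T\<close> by (simp add: compact_space_subtopology)
    show "Hausdorff_space (top_of_set T) \<or> regular_space (top_of_set T) \<or> normal_space (top_of_set T)"
      by (simp add: Hausdorff_space_subtopology)
    show "compactin (top_of_set T) {a}"
      using \<open>a \<in> T\<close> by simp
    show "closedin (top_of_set T) (T - ball a r)"
      using closedin_diff[of "top_of_set T" T "T \<inter> ball a r"] openin_open_Int[of "ball a r" T]
      by (simp add: Diff_Int)
    show "disjnt C {a} \<or> disjnt C (T - ball a r)" if "connectedin (top_of_set T) C" for C
    proof -
      have "C \<subseteq> T" "connected C"
        using that by (auto simp: connectedin_subtopology)
      then obtain b where "C \<subseteq> {b}"
        using assms(2) unfolding totally_disconnected_def by metis
      then have "x = y" if "x \<in> C" "y \<in> C" for x y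
        using that by blast
      then show ?thesis
        using \<open>r > 0\<close> by (force simp: disjnt_def)
    qed
  qed
  then obtain K where "closedin (top_of_set T) K" "openin (top_of_set T) K" "a \<in> K"
    and "T - ball a r \<subseteq> T - K"
    unfolding separated_between by auto
  moreover have "K \<subseteq> T"
    using \<open>openin (top_of_set T) K\<close> openin_imp_subset by blast
  ultimately show ?thesis
    using that by blast
qed

text \<open>Cover \<open>T\<close> by finitely many small clopen pieces \<open>K\<close>, each at positive distance from \<open>T - K\<close>.
  If \<open>\<beta>\<close> is less than half of all these distances, the \<open>\<beta>\<close>-neighbourhoods of \<open>K\<close> and of \<open>T - K\<close>
  are disjoint, so a connected set near \<open>T\<close> cannot be near both.\<close>

lemma connected_sets_near_totally_disconnected_are_small:
  fixes T :: "'a::metric_space set"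
  assumes "compact T" and "totally_disconnected T" and "\<epsilon> > 0"
  obtains \<beta> where "\<beta> > 0"
    and "\<And>C u v. \<lbrakk>connected C; \<And>c. c \<in> C \<Longrightarrow> \<exists>t\<in>T. dist c t < \<beta>; u \<in> C; v \<in> C\<rbrakk> \<Longrightarrow> dist u v \<le> \<epsilon>"
proof -
  have "\<exists>K e. openin (top_of_set T) K \<and> a \<in> K \<and> K \<subseteq> ball a (\<epsilon>/4) \<and> e > 0
      \<and> (\<forall>s\<in>K. \<forall>t\<in>T-K. e \<le> dist s t)" if a: "a \<in> T" for a
  proof -
    obtain K where K: "openin (top_of_set T) K" "closedin (top_of_set T) K" "a \<in> K"
        "K \<subseteq> ball a (\<epsilon>/4)"
      using totally_disconnected_clopen_base[OF assms(1,2) a, of "\<epsilon>/4"] \<open>\<epsilon> > 0\<close> by auto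
    have "compact K"
      using K(2) \<open>compact T\<close> closedin_compact by blast
    moreover have "closed (T - K)"
      using K(1) \<open>compact T\<close>
      by (metis closedin_compact closedin_diff closedin_topspace compact_imp_closed topspace_euclidean_subtopology)
    moreover have "K \<subseteq> - (T - K)"
      by blast
    ultimately obtain e where "e > 0" "(\<Union>s\<in>K. ball s e) \<subseteq> - (T - K)"
      using compact_subset_open_imp_ball_epsilon_subset open_Compl by metis
    then have "\<forall>s\<in>K. \<forall>t\<in>T-K. e \<le> dist s t"
      by (force simp: not_less[symmetric])
    then show ?thesis using K \<open>e > 0\<close> by blast
  qed
  then obtain K e where Ke: "\<And>a. a \<in> T \<Longrightarrow> openin (top_of_set T) (K a) \<and> a \<in> K a
      \<and> K a \<subseteq> ball a (\<epsilon>/4) \<and> e a > 0 \<and> (\<forall>s\<in>K a. \<forall>t\<in>T-K a. e a \<le> dist s t)"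
    by metis
  then have K: "\<And>a. a \<in> T \<Longrightarrow> openin (top_of_set T) (K a)" "\<And>a. a \<in> T \<Longrightarrow> a \<in> K a"
      "\<And>a. a \<in> T \<Longrightarrow> K a \<subseteq> ball a (\<epsilon>/4)" and e: "\<And>a. a \<in> T \<Longrightarrow> e a > 0"
      "\<And>a s t. \<lbrakk>a \<in> T; s \<in> K a; t \<in> T; t \<notin> K a\<rbrakk> \<Longrightarrow> e a \<le> dist s t"
    by blast+
  obtain \<D> where "\<D> \<subseteq> K ` T" "finite \<D>" "T \<subseteq> \<Union>\<D>"
  proof -
    have "(\<forall>c\<in>K ` T. openin (top_of_set T) c) \<and> T \<subseteq> \<Union>(K ` T)"
      using K by blast
    then show ?thesis
      using that \<open>compact T\<close> unfolding compact_eq_openin_cover by metis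
  qed
  then obtain A where A: "A \<subseteq> T" "finite A" "T \<subseteq> (\<Union>a\<in>A. K a)"
    by (metis finite_subset_image)
  define \<beta> where "\<beta> = Min (insert (\<epsilon>/4) ((\<lambda>a. e a / 2) ` A))"
  have "\<beta> > 0"
    using A e(1) \<open>\<epsilon> > 0\<close> by (auto simp: \<beta>_def)
  have \<beta>_le: "\<beta> \<le> \<epsilon>/4" "\<And>a. a \<in> A \<Longrightarrow> \<beta> \<le> e a / 2"
    unfolding \<beta>_def by (rule Min_le; use A(2) in auto)+
  have "dist u v \<le> \<epsilon>"
    if "connected C" and near: "\<And>c. c \<in> C \<Longrightarrow> \<exists>t\<in>T. dist c t < \<beta>" and "u \<in> C" "v \<in> C" for C u v
  proof -
    obtain t where "t \<in> T" "dist u t < \<beta>"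
      using near[OF \<open>u \<in> C\<close>] by blast
    then obtain a where "a \<in> A" "t \<in> K a"
      using A(3) by blast
    then have "a \<in> T"
      using A(1) by blast
    define P where "P = (\<Union>s\<in>K a. ball s \<beta>)"
    define Q where "Q = (\<Union>s\<in>T - K a. ball s \<beta>)"
    have "open P" "open Q"
      by (auto simp: P_def Q_def)
    moreover have "P \<inter> Q = {}"
    proof -
      have False if "s \<in> K a" "t \<in> T" "t \<notin> K a" "dist s x < \<beta>" "dist t x < \<beta>" for s t x
        using e(2)[OF \<open>a \<in> T\<close> that(1-3)] \<beta>_le(2)[OF \<open>a \<in> A\<close>] that(4,5)
          dist_triangle3[of s t x] by (simp add: dist_commute)
      then show ?thesis by (force simp: P_def Q_def)
    qed
    moreover have "C \<subseteq> P \<union> Q"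
      using near by (force simp: P_def Q_def dist_commute)
    moreover have "u \<in> P \<inter> C"
      using \<open>u \<in> C\<close> \<open>t \<in> K a\<close> \<open>dist u t < \<beta>\<close> by (auto simp: P_def dist_commute)
    ultimately have "C \<subseteq> P"
      using \<open>connected C\<close> connectedD[of C P Q] by blast
    have "dist a c < \<epsilon>/2" if c: "c \<in> C" for c
    proof -
      obtain s where "s \<in> K a" "dist s c < \<beta>"
        using c \<open>C \<subseteq> P\<close> by (auto simp: P_def)
      then show ?thesis
        using K(3)[OF \<open>a \<in> T\<close>] \<beta>_le(1) dist_triangle[of a c s] by force
    qed
    from this[OF \<open>u \<in> C\<close>] this[OF \<open>v \<in> C\<close>] show ?thesis
      using dist_triangle3[of u v a] by linarith
  qed
  then show ?thesis
    using that \<open>\<beta> > 0\<close> by blast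
qed

section \<open>Stability up to a given error\<close>

text \<open>Comparing two pseudo orbits, whose initial points may both vary, makes this set open and
  avoids singling out a true orbit.\<close>

definition stable_set :: "'a::metric_space set \<Rightarrow> ('a \<Rightarrow> 'a) \<Rightarrow> real \<Rightarrow> 'a set" where
  "stable_set X f \<epsilon> = {p \<in> X. \<exists>r>0. \<forall>x y. pseudo_orbit X f r x \<and> pseudo_orbit X f r y \<and>
     dist p (x 0) < r \<and> dist p (y 0) < r \<longrightarrow> (\<forall>i. dist (x i) (y i) \<le> \<epsilon>)}"

lemma pseudo_orbit_mono: "pseudo_orbit X f \<delta> x \<Longrightarrow> \<delta> \<le> \<eta> \<Longrightarrow> pseudo_orbit X f \<eta> x"
  unfolding pseudo_orbit_def by (meson order_trans)

lemma funpow_in_space: "f \<in> X \<rightarrow> X \<Longrightarrow> p \<in> X \<Longrightarrow> (f ^^ i) p \<in> X"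
  by (induction i) auto

lemma openin_stable_set: "openin (top_of_set X) (stable_set X f \<epsilon>)"
  unfolding openin_euclidean_subtopology_iff
proof (intro conjI ballI)
  show "stable_set X f \<epsilon> \<subseteq> X"
    by (auto simp: stable_set_def)
  fix p assume "p \<in> stable_set X f \<epsilon>"
  then obtain r where "r > 0" and r: "\<And>x y. \<lbrakk>pseudo_orbit X f r x; pseudo_orbit X f r y;
      dist p (x 0) < r; dist p (y 0) < r\<rbrakk> \<Longrightarrow> \<forall>i. dist (x i) (y i) \<le> \<epsilon>"
    unfolding stable_set_def by blast
  have "q \<in> stable_set X f \<epsilon>" if "q \<in> X" "dist q p < r/2" for q
  proof -
    have near: "dist p z < r" if "dist q z < r/2" for z
      using that \<open>dist q p < r/2\<close> dist_triangle3[of p z q] by simp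
    have "\<forall>i. dist (x i) (y i) \<le> \<epsilon>" if "pseudo_orbit X f (r/2) x" "pseudo_orbit X f (r/2) y"
        "dist q (x 0) < r/2" "dist q (y 0) < r/2" for x y
    proof (rule r)
      show "pseudo_orbit X f r x" "pseudo_orbit X f r y"
        using that(1,2) \<open>r > 0\<close> by (auto elim: pseudo_orbit_mono)
    qed (use that near in auto)
    then show ?thesis
      using \<open>q \<in> X\<close> \<open>r > 0\<close> unfolding stable_set_def by (auto intro!: exI[of _ "r/2"])
  qed
  then show "\<exists>e>0. \<forall>q\<in>X. dist q p < e \<longrightarrow> q \<in> stable_set X f \<epsilon>"
    using \<open>r > 0\<close> by (intro exI[of _ "r/2"]) auto
qed

text \<open>Moving the initial point of a pseudo orbit to \<open>p\<close> costs, by continuity of \<open>f\<close> at \<open>p\<close>, only a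
  small error in the first step; so chain continuity at \<open>p\<close> controls all pseudo orbits that start
  near \<open>p\<close>.\<close>

lemma chain_continuous_imp_stable:
  assumes "continuous_on X f" and "p \<in> X" and "chain_continuous_at X f p" and "\<epsilon> > 0"
  shows "p \<in> stable_set X f \<epsilon>"
proof -
  obtain \<delta> where "\<delta> > 0" and \<delta>: "\<And>x. pseudo_orbit X f \<delta> x \<Longrightarrow> x 0 = p \<Longrightarrow> shadowed_by f (\<epsilon>/2) x p"
    using assms(3) \<open>\<epsilon> > 0\<close> unfolding chain_continuous_at_def by (metis half_gt_zero)
  obtain s where "s > 0" and s: "\<And>q. q \<in> X \<Longrightarrow> dist q p < s \<Longrightarrow> dist (f q) (f p) < \<delta>/2"
    using assms(1) \<open>p \<in> X\<close> \<open>\<delta> > 0\<close> unfolding continuous_on_iff by (metis half_gt_zero)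
  define r where "r = min (min s (\<delta>/2)) (\<epsilon>/2)"
  have "r > 0" "r \<le> s" "r \<le> \<delta>/2" "r \<le> \<epsilon>/2"
    using \<open>s > 0\<close> \<open>\<delta> > 0\<close> \<open>\<epsilon> > 0\<close> by (auto simp: r_def)
  have follow: "dist ((f ^^ i) p) (x i) \<le> \<epsilon>/2" if x: "pseudo_orbit X f r x" "dist p (x 0) < r" for x i
  proof -
    have "dist (f p) (x 1) \<le> \<delta>"
    proof -
      have "dist (f (x 0)) (f p) < \<delta>/2"
        using s[of "x 0"] x \<open>r \<le> s\<close> by (auto simp: pseudo_orbit_def dist_commute)
      moreover have "dist (f (x 0)) (x 1) \<le> \<delta>/2"
        using x(1) \<open>r \<le> \<delta>/2\<close> unfolding pseudo_orbit_def by (metis One_nat_def order_trans)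
      ultimately show ?thesis
        using dist_triangle3[of "f p" "x 1" "f (x 0)"] by simp
    qed
    moreover have "dist (f (x i)) (x (Suc i)) \<le> \<delta>" for i
      using pseudo_orbit_mono[OF x(1), of \<delta>] \<open>r \<le> \<delta>/2\<close> \<open>\<delta> > 0\<close> by (simp add: pseudo_orbit_def)
    ultimately have "pseudo_orbit X f \<delta> (x(0 := p))"
      using x(1) \<open>p \<in> X\<close> by (auto simp: pseudo_orbit_def)
    then have "dist ((f ^^ i) p) ((x(0 := p)) i) \<le> \<epsilon>/2"
      using \<delta> unfolding shadowed_by_def by (metis fun_upd_same)
    then show ?thesis
      using x(2) \<open>r \<le> \<epsilon>/2\<close> by (cases "i = 0") auto
  qed
  have "dist (x i) (y i) \<le> \<epsilon>" if "pseudo_orbit X f r x" "pseudo_orbit X f r y"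
      "dist p (x 0) < r" "dist p (y 0) < r" for x y i
    using follow[OF that(1,3), of i] follow[OF that(2,4), of i]
      dist_triangle3[of "x i" "y i" "(f ^^ i) p"] by simp
  then show ?thesis
    using \<open>p \<in> X\<close> \<open>r > 0\<close> unfolding stable_set_def by blast
qed

lemma chain_continuity_set_eq_Inter_stable:
  assumes "continuous_on X f" and "f \<in> X \<rightarrow> X"
  shows "chain_continuity_set X f = (\<Inter>n. stable_set X f (1 / real (Suc n)))"
proof (intro equalityI subsetI)
  fix p assume "p \<in> chain_continuity_set X f"
  then show "p \<in> (\<Inter>n. stable_set X f (1 / real (Suc n)))"
    using chain_continuous_imp_stable[OF assms(1)] by (simp add: chain_continuity_set_def)
next
  fix p assume p: "p \<in> (\<Inter>n. stable_set X f (1 / real (Suc n)))"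
  then have "p \<in> X"
    by (auto simp: stable_set_def)
  have "chain_continuous_at X f p"
    unfolding chain_continuous_at_def
  proof (intro allI impI)
    fix \<epsilon> :: real assume "\<epsilon> > 0"
    then obtain n where n: "1 / real (Suc n) < \<epsilon>"
      using reals_Archimedean by (auto simp: inverse_eq_divide)
    have "p \<in> stable_set X f (1 / real (Suc n))"
      using p by blast
    then obtain r where "r > 0" and r: "\<And>x y. \<lbrakk>pseudo_orbit X f r x; pseudo_orbit X f r y;
        dist p (x 0) < r; dist p (y 0) < r\<rbrakk> \<Longrightarrow> \<forall>i. dist (x i) (y i) \<le> 1 / real (Suc n)"
      unfolding stable_set_def by blast
    have orbit: "pseudo_orbit X f r (\<lambda>i. (f ^^ i) p)"
      using funpow_in_space[OF assms(2) \<open>p \<in> X\<close>] \<open>r > 0\<close> by (simp add: pseudo_orbit_def)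
    have "dist ((f ^^ i) p) (x i) \<le> \<epsilon>" if "pseudo_orbit X f r x" "x 0 = p" for x i
    proof -
      have "dist ((f ^^ i) p) (x i) \<le> 1 / real (Suc n)"
        using r[of "\<lambda>i. (f ^^ i) p" x] orbit that \<open>r > 0\<close> by simp
      then show ?thesis using n by linarith
    qed
    then have "shadowed_by f \<epsilon> x p" if "pseudo_orbit X f r x" "x 0 = p" for x
      using that by (simp add: shadowed_by_def)
    then show "\<exists>\<delta>>0. \<forall>x. pseudo_orbit X f \<delta> x \<and> x 0 = p \<longrightarrow> shadowed_by f \<epsilon> x p"
      using \<open>r > 0\<close> by blast
  qed
  then show "p \<in> chain_continuity_set X f"
    using \<open>p \<in> X\<close> by (simp add: chain_continuity_set_def)
qed

text \<open>Shadowing replaces the two pseudo orbits to be compared by two true orbits that start near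
  \<open>p\<close>; the three errors add up to \<open>\<epsilon>\<close>.\<close>

lemma equicontinuous_imp_stable:
  assumes "shadowing_property X f" and "p \<in> X" and "r > 0" and "\<epsilon> > 0"
    and small: "\<And>y z i. \<lbrakk>y \<in> X; z \<in> X; dist p y < r; dist p z < r\<rbrakk>
      \<Longrightarrow> dist ((f ^^ i) y) ((f ^^ i) z) \<le> \<epsilon>/3"
  shows "p \<in> stable_set X f \<epsilon>"
proof -
  define \<eta> where "\<eta> = min (\<epsilon>/3) (r/2)"
  have "\<eta> > 0" "\<eta> \<le> \<epsilon>/3" "\<eta> \<le> r/2"
    using \<open>r > 0\<close> \<open>\<epsilon> > 0\<close> by (auto simp: \<eta>_def)
  obtain \<delta> where "\<delta> > 0" and \<delta>: "\<And>x. pseudo_orbit X f \<delta> x \<Longrightarrow> \<exists>q\<in>X. shadowed_by f \<eta> x q"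
    using assms(1) \<open>\<eta> > 0\<close> unfolding shadowing_property_def by blast
  define s where "s = min \<delta> (r/2)"
  have "s > 0" "s \<le> \<delta>" "s \<le> r/2"
    using \<open>r > 0\<close> \<open>\<delta> > 0\<close> by (auto simp: s_def)
  have shadow: "\<exists>q\<in>X. dist p q < r \<and> shadowed_by f \<eta> x q"
    if x: "pseudo_orbit X f s x" "dist p (x 0) < s" for x
  proof -
    obtain q where "q \<in> X" and q: "shadowed_by f \<eta> x q"
      using \<delta> pseudo_orbit_mono[OF x(1) \<open>s \<le> \<delta>\<close>] by blast
    have "dist q (x 0) \<le> \<eta>"
      using q unfolding shadowed_by_def by (metis funpow_0)
    then have "dist p q < r"
      using x(2) \<open>s \<le> r/2\<close> \<open>\<eta> \<le> r/2\<close> dist_triangle2[of p q "x 0"] by simp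
    then show ?thesis using \<open>q \<in> X\<close> q by blast
  qed
  have "dist (x i) (y i) \<le> \<epsilon>" if xy: "pseudo_orbit X f s x" "pseudo_orbit X f s y"
      "dist p (x 0) < s" "dist p (y 0) < s" for x y i
  proof -
    obtain a b where ab: "a \<in> X" "dist p a < r" "shadowed_by f \<eta> x a"
        "b \<in> X" "dist p b < r" "shadowed_by f \<eta> y b"
      using shadow[OF xy(1,3)] shadow[OF xy(2,4)] by blast
    have "dist ((f ^^ i) a) (x i) \<le> \<epsilon>/3" "dist ((f ^^ i) b) (y i) \<le> \<epsilon>/3"
      using ab(3,6) \<open>\<eta> \<le> \<epsilon>/3\<close> unfolding shadowed_by_def by (meson order_trans)+
    moreover have "dist ((f ^^ i) a) ((f ^^ i) b) \<le> \<epsilon>/3"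
      using small ab by blast
    ultimately show ?thesis
      using dist_triangle3[of "x i" "y i" "(f ^^ i) a"]
        dist_triangle[of "(f ^^ i) a" "y i" "(f ^^ i) b"] by linarith
  qed
  then show ?thesis
    using \<open>p \<in> X\<close> \<open>s > 0\<close> unfolding stable_set_def by blast
qed

section \<open>Density of the stable sets\<close>

lemma continuous_on_funpow:
  assumes "continuous_on X f" and "f \<in> X \<rightarrow> X"
  shows "continuous_on X (f ^^ n)"
proof (induction n)
  case (Suc n)
  have "(f ^^ n) ` X \<subseteq> X"
    using funpow_in_space[OF assms(2)] by blast
  then show ?case
    using continuous_on_compose[OF Suc continuous_on_subset[OF assms(1)]] by simp
qed (simp add: id_def)

text \<open>A chain followed by the orbit of its last point is a pseudo orbit, and a shadowing point
  traverses it.\<close>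

lemma shadowing_orbit_connects:
  assumes "shadowing_property X f" and "f \<in> X \<rightarrow> X" and "w \<in> reachable_set X f p" and "\<eta> > 0"
  obtains y n where "y \<in> X" "dist y p \<le> \<eta>" "dist ((f ^^ n) y) (f w) \<le> \<eta>"
proof -
  obtain \<delta> where "\<delta> > 0" and \<delta>: "\<And>x. pseudo_orbit X f \<delta> x \<Longrightarrow> \<exists>q\<in>X. shadowed_by f \<eta> x q"
    using assms(1) \<open>\<eta> > 0\<close> unfolding shadowing_property_def by blast
  have "\<exists>k x. delta_chain X f \<delta> k x \<and> x 0 = p \<and> x k = w"
    using assms(3) \<open>\<delta> > 0\<close> by (simp add: delta_chain_iff_tranclp reachable_set_def)
  then obtain k x where x: "delta_chain X f \<delta> k x" "x 0 = p" "x k = w"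
    by blast
  define z where "z i = (if i \<le> k then x i else (f ^^ (i - k)) w)" for i
  have "w \<in> X"
    using assms(3) reachable_set_subset[of X f p] by blast
  have "dist (f (z i)) (z (Suc i)) \<le> \<delta>" for i
  proof (cases "i < k")
    case True
    then show ?thesis using x(1) by (auto simp: z_def delta_chain_def)
  next
    case False
    then have "z (Suc i) = f (z i)"
      using x(3) by (cases "i = k") (auto simp: z_def Suc_diff_le)
    then show ?thesis using \<open>\<delta> > 0\<close> by simp
  qed
  moreover have "z i \<in> X" for i
    using x(1) funpow_in_space[OF assms(2) \<open>w \<in> X\<close>] by (auto simp: z_def delta_chain_def)
  ultimately obtain y where "y \<in> X" and y: "shadowed_by f \<eta> z y"
    using \<delta> unfolding pseudo_orbit_def by blast
  have "dist ((f ^^ 0) y) (z 0) \<le> \<eta>" "dist ((f ^^ Suc k) y) (z (Suc k)) \<le> \<eta>"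
    using y unfolding shadowed_by_def by blast+
  then show ?thesis
    using that[of y "Suc k"] \<open>y \<in> X\<close> x(2) by (simp add: z_def)
qed

text \<open>The shadowing orbit enters the region from which orbits cannot escape the neighbourhood of a
  terminal class \<open>T\<close>. Connectedness then does what contraction would do: the late iterates of a
  connected neighbourhood are trapped in small separated pieces around \<open>T\<close>.\<close>

lemma stable_set_dense:
  fixes X :: "'a::metric_space set"
  assumes "compact X" and "continuous_on X f" and "f \<in> X \<rightarrow> X" and "locally connected X"
    and "shadowing_property X f" and "totally_disconnected (chain_recurrent_set X f)"
    and "p \<in> X" and "\<rho> > 0" and "\<epsilon> > 0"
  shows "\<exists>y\<in>stable_set X f \<epsilon>. dist y p < \<rho>"
proof -
  obtain w where w: "w \<in> reachable_set X f p"
    and "reachable_set X f w \<subseteq> chain_recurrent_set X f"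
    using terminal_chain_class[OF assms(1,3,7)] by blast
  define T where "T = reachable_set X f w"
  have "compact T"
    unfolding T_def by (rule compact_reachable_set[OF \<open>compact X\<close>])
  have "totally_disconnected T"
    using assms(6) \<open>reachable_set X f w \<subseteq> _\<close> unfolding T_def totally_disconnected_def by blast
  obtain \<beta> where "\<beta> > 0" and \<beta>: "\<And>C u v. \<lbrakk>connected C; \<And>c. c \<in> C \<Longrightarrow> \<exists>t\<in>T. dist c t < \<beta>;
      u \<in> C; v \<in> C\<rbrakk> \<Longrightarrow> dist u v \<le> \<epsilon>/3"
    using connected_sets_near_totally_disconnected_are_small
      [OF \<open>compact T\<close> \<open>totally_disconnected T\<close>, of "\<epsilon>/3"] \<open>\<epsilon> > 0\<close> by auto
  obtain \<delta> where "\<delta> > 0"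
    and \<delta>: "\<And>q. (chain_step X f \<delta>)\<^sup>+\<^sup>+ w q \<Longrightarrow> \<exists>t\<in>T. dist q t < \<beta>"
    unfolding T_def using fine_chains_stay_near_reachable_set[OF \<open>compact X\<close> \<open>\<beta> > 0\<close>, of f w] by metis
  have "w \<in> X"
    using w reachable_set_subset[of X f p] by blast
  \<comment> \<open>The orbit of a point \<open>\<delta>\<close>-close to \<open>f w\<close> is the tail of a \<open>\<delta>\<close>-chain that starts at \<open>w\<close>.\<close>
  have stays: "\<exists>t\<in>T. dist ((f ^^ i) q) t < \<beta>" if "q \<in> X" "dist q (f w) < \<delta>" for q i
  proof (rule \<delta>)
    show "(chain_step X f \<delta>)\<^sup>+\<^sup>+ w ((f ^^ i) q)"
    proof (induction i)
      case 0
      have "chain_step X f \<delta> w q"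
        using that \<open>w \<in> X\<close> by (simp add: chain_step_def dist_commute)
      then show ?case by auto
    next
      case (Suc i)
      have "chain_step X f \<delta> ((f ^^ i) q) ((f ^^ Suc i) q)"
        using funpow_in_space[OF assms(3) \<open>q \<in> X\<close>, of i] funpow_in_space[OF assms(3) \<open>q \<in> X\<close>, of "Suc i"]
          \<open>\<delta> > 0\<close> by (simp add: chain_step_def)
      then show ?case using Suc by (rule tranclp.trancl_into_trancl[rotated])
    qed
  qed
  define \<eta> where "\<eta> = min \<delta> \<rho> / 2"
  have "\<eta> > 0" "\<eta> < \<delta>" "\<eta> < \<rho>"
    using \<open>\<delta> > 0\<close> \<open>\<rho> > 0\<close> by (auto simp: \<eta>_def)
  obtain y n where "y \<in> X" "dist y p \<le> \<eta>" and yn: "dist ((f ^^ n) y) (f w) \<le> \<eta>"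
    using shadowing_orbit_connects[OF assms(5,3) w \<open>\<eta> > 0\<close>] by blast
  \<comment> \<open>The iterates before \<open>n\<close> are kept small by continuity, the later ones by \<open>\<beta>\<close>.\<close>
  define U where "U = (\<Inter>i\<le>n. X \<inter> (f ^^ i) -` ball ((f ^^ i) y) (\<epsilon>/6)) \<inter>
    (X \<inter> (f ^^ n) -` ball (f w) \<delta>)"
  have "openin (top_of_set X) U"
    unfolding U_def
    by (intro openin_Int openin_INT2 continuous_openin_preimage_gen continuous_on_funpow assms(2,3) open_ball)
      auto
  moreover have "y \<in> U"
    using \<open>y \<in> X\<close> yn \<open>\<eta> < \<delta>\<close> \<open>\<epsilon> > 0\<close> by (auto simp: U_def dist_commute)
  ultimately obtain V where V: "openin (top_of_set X) V" "connected V" "y \<in> V" "V \<subseteq> U"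
    using assms(4) unfolding locally_connected_iff_open_base by metis
  have "V \<subseteq> X"
    using V(1) openin_imp_subset by blast
  have small: "dist ((f ^^ i) a) ((f ^^ i) b) \<le> \<epsilon>/3" if "a \<in> V" "b \<in> V" for a b i
  proof (cases "i \<le> n")
    case True
    then have "dist ((f ^^ i) y) ((f ^^ i) a) < \<epsilon>/6" "dist ((f ^^ i) y) ((f ^^ i) b) < \<epsilon>/6"
      using that V(4) by (auto simp: U_def)
    then show ?thesis
      using dist_triangle3[of "(f ^^ i) a" "(f ^^ i) b" "(f ^^ i) y"] by simp
  next
    case False
    show ?thesis
    proof (rule \<beta>)
      show "connected ((f ^^ i) ` V)"
        using V(2) continuous_on_subset[OF continuous_on_funpow[OF assms(2,3)] \<open>V \<subseteq> X\<close>]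
        by (rule connected_continuous_image[rotated])
      show "\<exists>t\<in>T. dist c t < \<beta>" if c: "c \<in> (f ^^ i) ` V" for c
      proof -
        obtain v where "v \<in> V" "c = (f ^^ i) v"
          using c by blast
        moreover have "(f ^^ i) v = (f ^^ (i - n)) ((f ^^ n) v)"
          using False by (metis comp_apply funpow_add le_add_diff_inverse2 nat_le_linear)
        moreover have "dist ((f ^^ n) v) (f w) < \<delta>"
          using \<open>v \<in> V\<close> V(4) by (auto simp: U_def dist_commute)
        ultimately show ?thesis
          using stays funpow_in_space[OF assms(3)] \<open>V \<subseteq> X\<close> by (metis subsetD)
      qed
    qed (use that in auto)
  qed
  obtain r where "r > 0" and r: "\<And>z. z \<in> X \<Longrightarrow> dist z y < r \<Longrightarrow> z \<in> V"
    using V(1,3) unfolding openin_euclidean_subtopology_iff by blast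
  have "y \<in> stable_set X f \<epsilon>"
    using equicontinuous_imp_stable[OF assms(5) \<open>y \<in> X\<close> \<open>r > 0\<close> \<open>\<epsilon> > 0\<close>] small r
    by (simp add: dist_commute)
  then show ?thesis
    using \<open>dist y p \<le> \<eta>\<close> \<open>\<eta> < \<rho>\<close> by force
qed

section \<open>Almost chain continuity\<close>

theorem theorem1p2:
  fixes X :: "'a::metric_space set" and f :: "'a \<Rightarrow> 'a"
  assumes "compact X"
    and "continuous_on X f" and "f \<in> X \<rightarrow> X"
    and "locally connected X"
    and "shadowing_property X f"
    and "totally_disconnected (chain_recurrent_set X f)"
  shows "almost_chain_continuous X f"
proof -
  define \<G> where "\<G> = range (\<lambda>n. stable_set X f (1 / real (Suc n)))"
  have CC: "chain_continuity_set X f = \<Inter>\<G>"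
    unfolding \<G>_def by (rule chain_continuity_set_eq_Inter_stable[OF assms(2,3)])
  have "countable \<G>" "\<G> \<noteq> {}"
    by (auto simp: \<G>_def)
  have op: "openin (top_of_set X) G" if "G \<in> \<G>" for G
    using that openin_stable_set by (auto simp: \<G>_def)
  have dense: "top_of_set X closure_of G = topspace (top_of_set X)" if "G \<in> \<G>" for G
  proof -
    obtain n where n: "G = stable_set X f (1 / real (Suc n))"
      using \<open>G \<in> \<G>\<close> by (auto simp: \<G>_def)
    have "p \<in> top_of_set X closure_of G" if "p \<in> X" for p
      unfolding in_closure_of
    proof (intro conjI allI impI)
      fix W assume "p \<in> W \<and> openin (top_of_set X) W"
      then obtain \<rho> where "\<rho> > 0" and \<rho>: "\<And>z. z \<in> X \<Longrightarrow> dist z p < \<rho> \<Longrightarrow> z \<in> W"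
        unfolding openin_euclidean_subtopology_iff by blast
      obtain y where "y \<in> G" "dist y p < \<rho>"
        using stable_set_dense[OF assms \<open>p \<in> X\<close> \<open>\<rho> > 0\<close>, of "1 / real (Suc n)"] n by auto
      moreover have "y \<in> X"
        using \<open>y \<in> G\<close> n by (auto simp: stable_set_def)
      ultimately show "\<exists>y. y \<in> G \<and> y \<in> W"
        using \<rho> by blast
    qed (use that in simp)
    then show ?thesis
      using closure_of_subset_topspace[of "top_of_set X" G] by auto
  qed
  have "top_of_set X closure_of \<Inter>\<G> = topspace (top_of_set X)"
  proof (rule Baire_category[OF disjI2])
    have "compact_space (top_of_set X)" "Hausdorff_space (top_of_set X)"
      using \<open>compact X\<close> by (simp_all add: compact_space_subtopology Hausdorff_space_subtopology)
    then show "locally_compact_space (top_of_set X) \<and> regular_space (top_of_set X)"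
      using compact_imp_locally_compact_space compact_Hausdorff_or_regular_imp_normal_space
        compact_Hausdorff_imp_regular_space by blast
  qed (use \<open>countable \<G>\<close> op dense in auto)
  moreover have "gdelta_in (top_of_set X) (\<Inter>\<G>)"
    by (rule gdelta_in_Inter[OF \<open>countable \<G>\<close> \<open>\<G> \<noteq> {}\<close>]) (simp add: op open_imp_gdelta_in)
  ultimately show ?thesis
    by (simp add: almost_chain_continuous_def CC)
qed

end
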